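(* Let $G$ be a group. For each $g \in G$ let $*_g \in Bin(G)$ be the binary operation on the underlying set of $G$ given by $a *_g b = a b^{-1} g b$ for all $a,b \in G$. Then the map $\phi^{reg}: G \to Bin(G)$, $\phi^{reg}(g) = *_g$, is a monomorphism (an injective homomorphism, sending the identity of $G$ to the identity of the monoid $Bin(G)$), and its image $\{*_g\}_{g\in G}$ is a distributive set. In particular, every group $G$ embeds in $Bin(G)$ as a distributive set of operations.
   Context: For a set $X$, $Bin(X)$ denotes the set of all binary operations on $X$. It is a monoid under the composition $*_1 *_2$ defined by $a \,( *_1 *_2)\, b = (a *_1 b) *_2 b$ for $a,b\in X$; its identity element is the right trivial operation $*_0$, given by $a *_0 b = a$ for all $a,b \in X$. A subset $S \subset Bin(X)$ is called a distributive set if for all $*_\alpha, *_\beta \in S$ (the case $*_\alpha = *_\beta$ is allowed) and all $a,b,c \in X$ one has $(a *_\alpha b) *_\beta c = (a *_\beta c) *_\alpha (b *_\beta c)$. For a group $G$, $Bin(G)$ means $Bin(X)$ with $X$ the underlying set of $G$. *)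

theory Defs
  imports "HOL-Algebra.Group"
begin

(* The operations are extensional (undefined off X) so that equality in Bin X is
   equality of binary operations on X.  Composition is read left to right. *)
definition Bin :: "'a set \<Rightarrow> ('a \<Rightarrow> 'a \<Rightarrow> 'a) monoid" where
  "Bin X = \<lparr>carrier = X \<rightarrow>\<^sub>E (X \<rightarrow>\<^sub>E X),
            mult = (\<lambda>f g. \<lambda>a\<in>X. \<lambda>b\<in>X. g (f a b) b),
            one = (\<lambda>a\<in>X. \<lambda>b\<in>X. a)\<rparr>"

lemma monoid_Bin: "monoid (Bin X)"
proof (rule monoidI)
  fix f g h
  assume "f \<in> carrier (Bin X)" "g \<in> carrier (Bin X)" "h \<in> carrier (Bin X)"
  then show "f \<otimes>\<^bsub>Bin X\<^esub> g \<otimes>\<^bsub>Bin X\<^esub> h = f \<otimes>\<^bsub>Bin X\<^esub> (g \<otimes>\<^bsub>Bin X\<^esub> h)"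
    by (auto simp: Bin_def PiE_iff fun_eq_iff restrict_def)
next
  fix f assume f: "f \<in> carrier (Bin X)"
  show "\<one>\<^bsub>Bin X\<^esub> \<otimes>\<^bsub>Bin X\<^esub> f = f" and "f \<otimes>\<^bsub>Bin X\<^esub> \<one>\<^bsub>Bin X\<^esub> = f"
    using f by (auto simp: Bin_def PiE_iff fun_eq_iff restrict_def extensional_def)
qed (auto simp: Bin_def PiE_iff)

definition distributive_set :: "'a set \<Rightarrow> ('a \<Rightarrow> 'a \<Rightarrow> 'a) set \<Rightarrow> bool" where
  "distributive_set X S \<longleftrightarrow> S \<subseteq> carrier (Bin X) \<and>
     (\<forall>f\<in>S. \<forall>g\<in>S. \<forall>a\<in>X. \<forall>b\<in>X. \<forall>c\<in>X. g (f a b) c = f (g a c) (g b c))"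

definition phi_reg :: "('a, 'm) monoid_scheme \<Rightarrow> 'a \<Rightarrow> 'a \<Rightarrow> 'a \<Rightarrow> 'a" where
  "phi_reg G g = (\<lambda>a\<in>carrier G. \<lambda>b\<in>carrier G.
     a \<otimes>\<^bsub>G\<^esub> inv\<^bsub>G\<^esub> b \<otimes>\<^bsub>G\<^esub> g \<otimes>\<^bsub>G\<^esub> b)"

end

theory Submission
  imports Defs
begin

text \<open>Each \<open>phi_reg G g\<close> sends (a, b) to a times the conjugate of g by b.
  Conjugation by b is multiplicative in g, so composing operations multiplies their indices
  (\<open>phi_reg_mult\<close>). Distributivity holds because acting by c is a right translation,
  with which every operation commutes.\<close>

context group
begin

text \<open>Once \<open>m_assoc\<close> nests products to the right, x and its inverse no longer
  form a subterm of their own; these rules cancel them there.\<close>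

lemma mult_inv_cancel:
  assumes "x \<in> carrier G" "y \<in> carrier G"
  shows "x \<otimes> (inv x \<otimes> y) = y" "inv x \<otimes> (x \<otimes> y) = y"
  using assms by (simp_all flip: m_assoc)

lemma phi_reg_apply:
  assumes "a \<in> carrier G" "b \<in> carrier G"
  shows "phi_reg G g a b = a \<otimes> inv b \<otimes> g \<otimes> b"
  using assms by (simp add: phi_reg_def)

lemma phi_reg_in_Bin:
  assumes "g \<in> carrier G"
  shows "phi_reg G g \<in> carrier (Bin (carrier G))"
  using assms by (auto simp: phi_reg_def Bin_def)

lemma phi_reg_one: "phi_reg G \<one> = \<one>\<^bsub>Bin (carrier G)\<^esub>"
  by (auto simp: phi_reg_def Bin_def m_assoc intro!: restrict_ext)

lemma phi_reg_mult:
  assumes "g \<in> carrier G" "h \<in> carrier G"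
  shows "phi_reg G (g \<otimes> h) = phi_reg G g \<otimes>\<^bsub>Bin (carrier G)\<^esub> phi_reg G h"
  using assms by (auto simp: phi_reg_def Bin_def m_assoc mult_inv_cancel intro!: restrict_ext)

lemma inj_on_phi_reg: "inj_on (phi_reg G) (carrier G)"
proof (rule inj_onI)
  fix g h
  assume gh: "g \<in> carrier G" "h \<in> carrier G" and "phi_reg G g = phi_reg G h"
  \<comment> \<open>At a = b = \<open>\<one>\<close> the operation returns its index.\<close>
  then have "phi_reg G g \<one> \<one> = phi_reg G h \<one> \<one>"
    by simp
  with gh show "g = h"
    by (simp add: phi_reg_apply)
qed

lemma phi_reg_mon: "phi_reg G \<in> mon G (Bin (carrier G))"
  by (auto simp: mon_def hom_def phi_reg_in_Bin phi_reg_mult inj_on_phi_reg)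

text \<open>For u = inv c g c, the operation of g with second argument c is right multiplication by
  u. Replacing a, b by au, bu in a (inv b) f b gives a u (inv u) (inv b) f b u, so u cancels inside
  and survives only at the right end.\<close>

lemma distributive_set_phi_reg: "distributive_set (carrier G) (phi_reg G ` carrier G)"
  by (auto simp: distributive_set_def phi_reg_in_Bin phi_reg_apply
      inv_mult_group m_assoc mult_inv_cancel)

end

theorem theorem2p1:
  fixes G :: "('a, 'm) monoid_scheme"
  assumes "group G"
  shows "phi_reg G \<in> mon G (Bin (carrier G)) \<and>
         phi_reg G \<one>\<^bsub>G\<^esub> = \<one>\<^bsub>Bin (carrier G)\<^esub> \<and>
         distributive_set (carrier G) (phi_reg G ` carrier G) \<and>
         (\<exists>\<psi> \<in> mon G (Bin (carrier G)).
            \<psi> \<one>\<^bsub>G\<^esub> = \<one>\<^bsub>Bin (carrier G)\<^esub> \<and>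
            distributive_set (carrier G) (\<psi> ` carrier G))"
  using assms group.phi_reg_mon group.phi_reg_one group.distributive_set_phi_reg by blast

end
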